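(* Let $G$ be an $n$-vertex graph, let $f:\mathbb{R}_{\ge0}\to\mathbb{R}_{\ge0}$ be a strictly increasing function, and let $d$ be a natural number. If the set system $(V(G),\mathcal{N}_G)$ has VC dimension $d$ and $\nu_G(m)\le f(m)$ for all $m\in[n]$, then \[ \mathrm{ctg}(G)\le 1+\log n + 5d\cdot\sum_{j=1}^{n}\frac{1}{f^{-1}(j/2)}. \]
   Context: $\mathcal{N}_G=\{N_G(v):v\in V(G)\}$ where $N_G(v)$ is the neighbor set of $v$. For a set system $(X,\mathcal{S})$ a set $A\subseteq X$ is shattered if $\{Y\cap A:Y\in\mathcal{S}\}=2^A$, and the VC dimension is the maximum size of a shattered set. The neighborhood complexity of $G$ is $\nu_G(m)=\max_{A\subseteq V(G),|A|=m}|\{N_G(v)\cap A: v\in V(G)\}|$. The contiguity $\mathrm{ctg}(G)$ is the minimum integer $k$ such that there is a linear order of $V(G)$ in which the neighborhood of each vertex can be partitioned into at most $k$ intervals. $f^{-1}$ denotes the inverse of $f$; $\log$ is base $2$. *)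

theory Defs
  imports Complex_Main "HOL-Library.Disjoint_Sets" "Graph_Theory.Digraph"
begin

text \<open>
  Graphs are finite and simple: the locale \<open>graph\<close> of Graph_Theory, i.e. finite symmetric
  loop-free digraphs without parallel arcs; \<open>arcs_ends G\<close> is the adjacency relation.
\<close>

definition nbhd :: "('a, 'b) pre_digraph \<Rightarrow> 'a \<Rightarrow> 'a set" where
  "nbhd G v = {u \<in> verts G. (v, u) \<in> arcs_ends G}"

definition nbhd_system :: "('a, 'b) pre_digraph \<Rightarrow> 'a set set" where
  "nbhd_system G = {nbhd G v | v. v \<in> verts G}"

definition shattered :: "'a set set \<Rightarrow> 'a set \<Rightarrow> bool" where
  "shattered S A \<longleftrightarrow> {Y \<inter> A | Y. Y \<in> S} = Pow A"

text \<open>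
  The maximum is meaningful for finite \<open>X\<close> and nonempty \<open>S\<close>, when \<open>{}\<close> is shattered.
\<close>
definition vc_dim :: "'a set \<Rightarrow> 'a set set \<Rightarrow> nat" where
  "vc_dim X S = Max {card A | A. A \<subseteq> X \<and> shattered S A}"

text \<open>Meaningful for \<open>m \<le> card (verts G)\<close>.\<close>
definition nbhd_complexity :: "('a, 'b) pre_digraph \<Rightarrow> nat \<Rightarrow> nat" where
  "nbhd_complexity G m =
     Max {card {nbhd G v \<inter> A | v. v \<in> verts G} | A. A \<subseteq> verts G \<and> card A = m}"

definition interval_in :: "'a set \<Rightarrow> 'a rel \<Rightarrow> 'a set \<Rightarrow> bool" where
  "interval_in V r I \<longleftrightarrow> I \<subseteq> V \<and>
     (\<forall>x\<in>I. \<forall>z\<in>I. \<forall>y\<in>V. (x, y) \<in> r \<and> (y, z) \<in> r \<longrightarrow> y \<in> I)"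

text \<open>
  The parts of a partition are nonempty, so an empty neighborhood is partitioned into 0 intervals.
\<close>
definition contiguity :: "('a, 'b) pre_digraph \<Rightarrow> nat" where
  "contiguity G = (LEAST k. \<exists>r. linear_order_on (verts G) r \<and>
     (\<forall>v\<in>verts G. \<exists>P. partition_on (nbhd G v) P \<and> card P \<le> k \<and>
        (\<forall>I\<in>P. interval_in (verts G) r I)))"

end

theory Submission
  imports Defs
begin

text \<open>
  Chazelle's proof of Haussler's packing lemma shows that among \<open>j\<close> vertices there are two whose
  neighborhoods differ by at most a fraction \<open>4d / f\<^sup>-\<^sup>1(j/2)\<close> of any given weight: if all
  differences were larger, a random sample of fewer than \<open>f\<^sup>-\<^sup>1(j/2)\<close> points would leave at least
  \<open>j/2\<close> distinct traces, contradicting the choice of \<open>f\<close>. Start from \<open>n\<close> one-vertex paths and repeatedly join two paths at designated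
  ends that are close for the weights \<open>2\<close> to the power of the number of path edges that
  leave or enter \<open>N(v)\<close>. The final path has total weight at most \<open>n \<Prod>j (1 + 4d / f\<^sup>-\<^sup>1(j/2))\<close>,
  and a neighborhood with \<open>k\<close> alternations along it consists of at most \<open>k/2 + 1\<close> intervals.
  The adjacency relation is symmetric, so the dual set system is the system itself.
\<close>

section \<open>Shattering and the weighted unit distance graph\<close>

lemma shattered_iff: "shattered S B \<longleftrightarrow> (\<forall>C. C \<subseteq> B \<longrightarrow> (\<exists>Y\<in>S. Y \<inter> B = C))"
proof -
  have "{Y \<inter> B | Y. Y \<in> S} \<subseteq> Pow B" by auto
  then have "shattered S B \<longleftrightarrow> Pow B \<subseteq> {Y \<inter> B | Y. Y \<in> S}"
    unfolding shattered_def by blast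
  then show ?thesis by blast
qed

text \<open>Only traces on \<open>B\<close> matter, so the second family may live on another ground
  set; this is how dimension bounds pass to projections and traces.\<close>

lemma shattered_trans:
  assumes "shattered S B" and "\<And>Y. Y \<in> S \<Longrightarrow> \<exists>Z\<in>S'. Z \<inter> B = Y \<inter> B"
  shows "shattered S' B"
  using assms unfolding shattered_iff by metis

lemma sum_Pow_insert:
  fixes g :: "'a set \<Rightarrow> real"
  assumes "finite X" "x \<notin> X"
  shows "(\<Sum>A\<in>Pow (insert x X). g A) = (\<Sum>A\<in>Pow X. g A) + (\<Sum>A\<in>Pow X. g (insert x A))"
proof -
  have inj: "inj_on (insert x) (Pow X)"
    using assms(2) by (intro inj_onI) (metis Pow_iff insert_ident subsetD)
  have "(\<Sum>A\<in>Pow (insert x X). g A) = (\<Sum>A\<in>Pow X \<union> insert x ` Pow X. g A)"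
    by (simp add: Pow_insert)
  also have "\<dots> = (\<Sum>A\<in>Pow X. g A) + (\<Sum>A\<in>insert x ` Pow X. g A)"
    using assms by (intro sum.union_disjoint) auto
  also have "(\<Sum>A\<in>insert x ` Pow X. g A) = (\<Sum>A\<in>Pow X. g (insert x A))"
    using sum.reindex[OF inj] by simp
  finally show ?thesis .
qed

text \<open>The four numbers are weights on a square spanned by directions \<open>x\<close> and
  \<open>y\<close>. The left side weighs its two edges in direction \<open>y\<close>, the right side
  their images under maxima and minima along \<open>x\<close>. The smaller of the two minima is the
  overall minimum; the larger is at most the minimum of the maxima.\<close>

lemma min_add_min_le:
  fixes a b a' b' :: real
  shows "min a b + min a' b' \<le> min (max a a') (max b b') + min (min a a') (min b b')"
proof -
  have "max (min a b) (min a' b') \<le> min (max a a') (max b b')"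
    by (intro max.boundedI min.boundedI) (simp_all add: le_max_iff_disj)
  moreover have "min (min a a') (min b b') = min (min a b) (min a' b')"
    by (simp add: min.assoc min.left_commute)
  moreover have "min a b + min a' b' = max (min a b) (min a' b') + min (min a b) (min a' b')"
    by (simp add: max_def min_def)
  ultimately show ?thesis by linarith
qed

text \<open>A weighted form of the bound \<open>d |F|\<close> on the number of edges of the unit distance graph of a
  family \<open>F\<close> of VC dimension \<open>d\<close>, where an edge weighs the minimum of its ends. In the induction,
  \<open>w1\<close> and \<open>w2\<close> play the roles of the projection of \<open>F\<close> away from \<open>x\<close> and of the family of
  sets that are in \<open>F\<close> both with and without \<open>x\<close>.\<close>
lemma weighted_unit_distance_bound:
  fixes w :: "'a set \<Rightarrow> real"
  assumes "finite X" and "\<And>A. w A \<ge> 0"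
    and "\<And>B. B \<subseteq> X \<Longrightarrow> shattered {A \<in> Pow X. w A > 0} B \<Longrightarrow> card B \<le> d"
  shows "(\<Sum>y\<in>X. \<Sum>A\<in>Pow (X - {y}). min (w A) (w (insert y A))) \<le> real d * (\<Sum>A\<in>Pow X. w A)"
  using assms
proof (induction X arbitrary: w d rule: finite_induct)
  case empty
  then show ?case by simp
next
  case (insert x X)
  define w1 where "w1 A = max (w A) (w (insert x A))" for A
  define w2 where "w2 A = min (w A) (w (insert x A))" for A
  have nn: "w1 A \<ge> 0" "w2 A \<ge> 0" for A
    using insert.prems(1) by (auto simp: w1_def w2_def le_max_iff_disj)
  let ?W = "\<lambda>X w. \<Sum>y\<in>X. \<Sum>A\<in>Pow (X - {y}). min (w A) (w (insert y A)) :: real"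
  have tot: "(\<Sum>A\<in>Pow (insert x X). w A) = (\<Sum>A\<in>Pow X. w1 A) + (\<Sum>A\<in>Pow X. w2 A)"
    unfolding sum_Pow_insert[OF insert.hyps] sum.distrib[symmetric]
    by (intro sum.cong) (auto simp: w1_def w2_def)
  have dir: "(\<Sum>A\<in>Pow (insert x X - {y}). min (w A) (w (insert y A)))
      \<le> (\<Sum>A\<in>Pow (X - {y}). min (w1 A) (w1 (insert y A)))
        + (\<Sum>A\<in>Pow (X - {y}). min (w2 A) (w2 (insert y A)))" if "y \<in> X" for y
  proof -
    have "insert x X - {y} = insert x (X - {y})" using that insert.hyps by auto
    moreover have "finite (X - {y})" "x \<notin> X - {y}" using insert.hyps by auto
    ultimately have "(\<Sum>A\<in>Pow (insert x X - {y}). min (w A) (w (insert y A))) =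
       (\<Sum>A\<in>Pow (X - {y}). min (w A) (w (insert y A)) + min (w (insert x A)) (w (insert y (insert x A))))"
      by (simp add: sum_Pow_insert sum.distrib)
    also have "\<dots> \<le> (\<Sum>A\<in>Pow (X - {y}). min (w1 A) (w1 (insert y A)) + min (w2 A) (w2 (insert y A)))"
      unfolding w1_def w2_def insert_commute[of y x] by (intro sum_mono min_add_min_le)
    finally show ?thesis by (simp add: sum.distrib)
  qed
  \<comment> \<open>The edges in direction \<open>x\<close> itself weigh exactly the total of
    \<open>w2\<close>.\<close>
  have "?W (insert x X) w = (\<Sum>A\<in>Pow X. w2 A)
      + (\<Sum>y\<in>X. \<Sum>A\<in>Pow (insert x X - {y}). min (w A) (w (insert y A)))"
    using insert.hyps by (simp add: w2_def)
  also have "\<dots> \<le> (\<Sum>A\<in>Pow X. w2 A) + (?W X w1 + ?W X w2)"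
    unfolding sum.distrib[symmetric, where A = X] by (intro add_mono order_refl sum_mono dir)
  finally have split: "?W (insert x X) w \<le> (\<Sum>A\<in>Pow X. w2 A) + (?W X w1 + ?W X w2)" .
  have W1: "?W X w1 \<le> real d * (\<Sum>A\<in>Pow X. w1 A)"
  proof (rule insert.IH[OF nn(1)])
    fix B assume B: "B \<subseteq> X" "shattered {A \<in> Pow X. w1 A > 0} B"
    have "shattered {A \<in> Pow (insert x X). w A > 0} B"
    proof (rule shattered_trans[OF B(2)])
      fix Y assume Y: "Y \<in> {A \<in> Pow X. w1 A > 0}"
      have "insert x Y \<inter> B = Y \<inter> B" using B(1) insert.hyps(2) by auto
      with Y show "\<exists>Z\<in>{A \<in> Pow (insert x X). w A > 0}. Z \<inter> B = Y \<inter> B"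
        by (cases "w Y > 0") (auto simp: w1_def less_max_iff_disj
            intro: exI[of _ Y] exI[of _ "insert x Y"])
    qed
    then show "card B \<le> d" using B(1) by (intro insert.prems(2)) auto
  qed
  \<comment> \<open>A set of positive \<open>w2\<close> weight has positive \<open>w\<close> weight
    both with and without \<open>x\<close>, so \<open>x\<close> can be added to any set shattered by
    the support of \<open>w2\<close>.\<close>
  have grow: "Suc (card B) \<le> d" if B: "B \<subseteq> X" "shattered {A \<in> Pow X. w2 A > 0} B" for B
  proof -
    have xB: "x \<notin> B" using B(1) insert.hyps(2) by auto
    have "shattered {A \<in> Pow (insert x X). w A > 0} (insert x B)"
      unfolding shattered_iff
    proof (intro allI impI)
      fix C assume C: "C \<subseteq> insert x B"
      then have "C - {x} \<subseteq> B" by auto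
      then obtain Y where Y: "Y \<subseteq> X" "w2 Y > 0" "Y \<inter> B = C - {x}"
        using B(2)[unfolded shattered_iff, rule_format, of "C - {x}"] by blast
      have "x \<notin> Y" using Y(1) insert.hyps(2) by auto
      show "\<exists>Z\<in>{A \<in> Pow (insert x X). w A > 0}. Z \<inter> insert x B = C"
      proof (cases "x \<in> C")
        case True
        then have "insert x Y \<inter> insert x B = C" using Y(3) by auto
        then show ?thesis using Y by (intro bexI[of _ "insert x Y"]) (auto simp: w2_def)
      next
        case False
        then have "Y \<inter> insert x B = C" using Y(3) \<open>x \<notin> Y\<close> by auto
        then show ?thesis using Y by (intro bexI[of _ Y]) (auto simp: w2_def)
      qed
    qed
    then have "card (insert x B) \<le> d" using B(1) by (intro insert.prems(2)) auto
    then show ?thesis using xB finite_subset[OF B(1) insert.hyps(1)] by simp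
  qed
  \<comment> \<open>The drop in dimension pays for the edges in direction \<open>x\<close>. Empty
    support is treated apart, as \<open>d\<close> may be 0 there; otherwise \<open>{}\<close> is
    shattered and \<open>grow\<close> gives \<open>d > 0\<close>.\<close>
  have W2: "?W X w2 + (\<Sum>A\<in>Pow X. w2 A) \<le> real d * (\<Sum>A\<in>Pow X. w2 A)"
  proof (cases "{A \<in> Pow X. w2 A > 0} = {}")
    case True
    then have "\<not> w2 A > 0" if "A \<subseteq> X" for A using that by blast
    with nn(2) have z: "w2 A = 0" if "A \<subseteq> X" for A
      using that by (metis less_eq_real_def)
    have "?W X w2 = 0"
      by (intro sum.neutral ballI) (subst (1 2) z; blast?; simp)
    moreover have "(\<Sum>A\<in>Pow X. w2 A) = 0"
      by (intro sum.neutral) (simp add: z)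
    ultimately show ?thesis by simp
  next
    case False
    then have "shattered {A \<in> Pow X. w2 A > 0} {}" unfolding shattered_iff by auto
    from grow[OF _ this] obtain e where e: "d = Suc e" by (cases d) auto
    have "?W X w2 \<le> real e * (\<Sum>A\<in>Pow X. w2 A)"
      by (rule insert.IH[OF nn(2)]) (use grow e in auto)
    then show ?thesis by (simp add: e algebra_simps)
  qed
  show ?case unfolding tot using split W1 W2 by (simp add: algebra_simps)
qed

section \<open>Independent sampling and exchangeability\<close>

text \<open>Expectation over \<open>n\<close> independent samples from \<open>p\<close>, with replacement.\<close>
primrec expect :: "'a set \<Rightarrow> ('a \<Rightarrow> real) \<Rightarrow> nat \<Rightarrow> ('a list \<Rightarrow> real) \<Rightarrow> real" where
  "expect X p 0 g = g []"
| "expect X p (Suc n) g = (\<Sum>x\<in>X. p x * expect X p n (\<lambda>xs. g (x # xs)))"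

lemma expect_mono:
  assumes "\<And>x. x \<in> X \<Longrightarrow> p x \<ge> 0"
    and "\<And>xs. set xs \<subseteq> X \<Longrightarrow> length xs = n \<Longrightarrow> g xs \<le> h xs"
  shows "expect X p n g \<le> expect X p n h"
  using assms(2)
proof (induction n arbitrary: g h)
  case (Suc n)
  then show ?case by (auto intro!: sum_mono mult_left_mono Suc.IH assms(1))
qed auto

lemma expect_const:
  assumes "(\<Sum>x\<in>X. p x) = 1"
  shows "expect X p n (\<lambda>_. c) = c"
  by (induction n) (simp_all add: assms flip: sum_distrib_right)

lemma expect_sum: "expect X p n (\<lambda>xs. \<Sum>i\<in>I. g i xs) = (\<Sum>i\<in>I. expect X p n (g i))"
proof (induction n arbitrary: g)
  case (Suc n)
  show ?case by (simp add: Suc sum_distrib_left sum.swap[of _ I])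
qed auto

text \<open>Samples are independent and identically distributed, so the one at position
  \<open>i\<close> may be drawn apart from the others. The induction peels off the first sample and
  swaps the two outer sums.\<close>

lemma expect_exchange:
  assumes "i \<le> n"
  shows "expect X p (Suc n) (\<lambda>xs. h (xs ! i) (take i xs @ drop (Suc i) xs))
    = (\<Sum>x\<in>X. p x * expect X p n (h x))"
  using assms
proof (induction i arbitrary: n h)
  case (Suc i)
  then obtain m where m: "n = Suc m" "i \<le> m" by (cases n) auto
  have "expect X p (Suc n) (\<lambda>xs. h (xs ! Suc i) (take (Suc i) xs @ drop (Suc (Suc i)) xs))
     = (\<Sum>y\<in>X. p y * expect X p (Suc m) (\<lambda>xs. h (xs ! i) (y # (take i xs @ drop (Suc i) xs))))"
    by (simp add: m)
  also have "\<dots> = (\<Sum>y\<in>X. p y * (\<Sum>x\<in>X. p x * expect X p m (\<lambda>zs. h x (y # zs))))"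
    using Suc.IH[OF m(2), of "\<lambda>x zs. h x (y # zs)" for y] by (intro sum.cong refl arg_cong2[of _ _ _ _ "(*)"])
  also have "\<dots> = (\<Sum>x\<in>X. p x * (\<Sum>y\<in>X. p y * expect X p m (\<lambda>zs. h x (y # zs))))"
    unfolding sum_distrib_left by (subst sum.swap) (simp add: mult.left_commute)
  finally show ?case by (simp add: m)
qed simp


lemma expect_cmult: "expect X p n (\<lambda>xs. c * g xs) = c * expect X p n g"
  by (induction n arbitrary: g) (simp_all add: sum_distrib_left mult.left_commute)

section \<open>Chazelle's sampling argument for separated families\<close>

text \<open>The total weight of the unit distance edges in direction \<open>a\<close> among the traces on \<open>insert a B\<close>,
  weighted by multiplicity.\<close>
definition split_weight :: "('b \<Rightarrow> 'a set) \<Rightarrow> 'b set \<Rightarrow> 'a set \<Rightarrow> 'a \<Rightarrow> real" where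
  "split_weight N Y B a = (\<Sum>T\<in>Pow B. min (real (card {y \<in> Y. N y \<inter> B = T \<and> a \<notin> N y}))
     (real (card {y \<in> Y. N y \<inter> B = T \<and> a \<in> N y})))"

lemma sum_card_fibres:
  assumes "finite Y" "finite B"
  shows "(\<Sum>T\<in>Pow B. real (card {y \<in> Y. N y \<inter> B = T})) = real (card Y)"
proof -
  have "(\<Sum>T\<in>Pow B. \<Sum>y\<in>{y \<in> Y. N y \<inter> B = T}. 1::real) = (\<Sum>y\<in>Y. 1)"
    using assms by (intro sum.group) auto
  then show ?thesis by simp
qed

lemma split_weight_nonneg: "split_weight N Y B a \<ge> 0"
  unfolding split_weight_def by (intro sum_nonneg) simp

text \<open>All \<open>y\<close> with one trace on \<open>B\<close> agree on a point of
  \<open>B\<close>, so one side of each split is empty. Hence a point drawn twice contributes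
  nothing.\<close>

lemma split_weight_member:
  assumes "a \<in> B"
  shows "split_weight N Y B a = 0"
  unfolding split_weight_def
proof (intro sum.neutral ballI)
  fix T assume "T \<in> Pow B"
  have "{y \<in> Y. N y \<inter> B = T \<and> a \<notin> N y} = {} \<or> {y \<in> Y. N y \<inter> B = T \<and> a \<in> N y} = {}"
    using assms by blast
  then show "min (real (card {y \<in> Y. N y \<inter> B = T \<and> a \<notin> N y}))
     (real (card {y \<in> Y. N y \<inter> B = T \<and> a \<in> N y})) = 0"
    by (elim disjE) (simp_all only: card.empty of_nat_0 min_def of_nat_0_le_iff, auto)
qed

text \<open>A sample that occurs once contributes the weight of the edges in its direction among the
  traces on \<open>set xs\<close>, counted with multiplicity; repeated samples contribute 0. So the
  sum is at most the total edge weight, to which \<open>weighted_unit_distance_bound\<close>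
  applies.\<close>

lemma sum_split_weight_le:
  assumes "finite Y" and "set xs \<subseteq> X"
    and vc: "\<And>B. B \<subseteq> X \<Longrightarrow> shattered (N ` Y) B \<Longrightarrow> card B \<le> d"
  shows "(\<Sum>i<length xs. split_weight N Y (set (take i xs @ drop (Suc i) xs)) (xs ! i))
    \<le> real d * real (card Y)"
proof -
  define A where "A = set xs"
  have A: "finite A" "A \<subseteq> X" using assms(2) by (auto simp: A_def)
  define w where "w T = real (card {y \<in> Y. N y \<inter> A = T})" for T
  define rest where "rest i = set (take i xs @ drop (Suc i) xs)" for i
  define I where "I = {i. i < length xs \<and> xs ! i \<notin> rest i}"
  have decomp: "A = insert (xs ! i) (rest i)" if "i < length xs" for i
    unfolding A_def rest_def by (subst id_take_nth_drop[OF that]) auto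
  have inj: "inj_on ((!) xs) I"
  proof (rule linorder_inj_onI)
    fix i k assume ik: "i < k" "i \<in> I" "k \<in> I"
    then have "xs ! i = take k xs ! i" "i < length (take k xs)" by (auto simp: I_def)
    then have "xs ! i \<in> rest k" unfolding rest_def by (metis UnCI nth_mem set_append)
    then show "xs ! i \<noteq> xs ! k" using ik(3) by (auto simp: I_def)
  qed auto
  have "(\<Sum>i<length xs. split_weight N Y (rest i) (xs ! i)) = (\<Sum>i\<in>I. split_weight N Y (rest i) (xs ! i))"
    by (intro sum.mono_neutral_right) (auto simp: I_def split_weight_member)
  also have "\<dots> = (\<Sum>i\<in>I. split_weight N Y (A - {xs ! i}) (xs ! i))"
    by (intro sum.cong refl arg_cong2[of _ _ _ _ "split_weight N Y"])
       (use decomp in \<open>auto simp: I_def\<close>)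
  also have "\<dots> = (\<Sum>a\<in>(!) xs ` I. split_weight N Y (A - {a}) a)"
    by (simp add: sum.reindex[OF inj])
  also have "\<dots> \<le> (\<Sum>a\<in>A. split_weight N Y (A - {a}) a)"
    by (intro sum_mono2 A split_weight_nonneg) (auto simp: I_def A_def)
  also have "\<dots> = (\<Sum>a\<in>A. \<Sum>T\<in>Pow (A - {a}). min (w T) (w (insert a T)))"
    unfolding split_weight_def w_def
    by (intro sum.cong refl arg_cong2[of _ _ _ _ min] arg_cong[of _ _ real] arg_cong[of _ _ card]) auto
  also have "\<dots> \<le> real d * (\<Sum>T\<in>Pow A. w T)"
  proof (rule weighted_unit_distance_bound[OF A(1)])
    fix B assume B: "B \<subseteq> A" "shattered {T \<in> Pow A. w T > 0} B"
    have "shattered (N ` Y) B"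
    proof (rule shattered_trans[OF B(2)])
      fix T assume "T \<in> {T \<in> Pow A. w T > 0}"
      then have "{y \<in> Y. N y \<inter> A = T} \<noteq> {}" unfolding w_def by force
      then obtain y where "y \<in> Y" "N y \<inter> A = T" by blast
      then show "\<exists>Z\<in>N ` Y. Z \<inter> B = T \<inter> B" using B(1) by blast
    qed
    then show "card B \<le> d" using vc B(1) A(2) by blast
  qed (simp add: w_def)
  also have "(\<Sum>T\<in>Pow A. w T) = real (card Y)"
    unfolding w_def by (rule sum_card_fibres[OF assms(1) A(1)])
  finally show ?thesis unfolding rest_def .
qed

text \<open>If \<open>x\<close> splits \<open>C\<close> into parts of sizes \<open>b0\<close> and \<open>b1\<close>, then \<open>min b0 b1 \<ge> b0 b1 / |C|\<close>, and
  \<open>b0 b1\<close> counts the pairs separated by \<open>x\<close>.\<close>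
lemma expected_split_class:
  fixes p :: "'a \<Rightarrow> real"
  assumes "finite C" and p: "\<And>x. x \<in> X \<Longrightarrow> p x \<ge> 0"
    and sep: "\<And>y z. y \<in> C \<Longrightarrow> z \<in> C \<Longrightarrow> y \<noteq> z \<Longrightarrow>
      \<delta> \<le> (\<Sum>x\<in>X. p x * of_bool ((x \<in> N y) \<noteq> (x \<in> N z)))"
  shows "\<delta> / 2 * (real (card C) - of_bool (C \<noteq> {}))
    \<le> (\<Sum>x\<in>X. p x * min (real (card {y \<in> C. x \<notin> N y})) (real (card {y \<in> C. x \<in> N y})))"
    (is "_ \<le> (\<Sum>x\<in>X. p x * min (?c0 x) (?c1 x))")
proof (cases "C = {}")
  case False
  define b where "b = real (card C)"
  have b: "b > 0" using False assms(1) by (simp add: b_def card_gt_0_iff)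
  have c0: "?c0 x = (\<Sum>y\<in>C. of_bool (x \<notin> N y))" and c1: "?c1 x = (\<Sum>y\<in>C. of_bool (x \<in> N y))" for x
    using assms(1) by (simp_all add: sum_of_bool_eq Int_def)
  have add: "?c0 x + ?c1 x = b" for x
    unfolding c0 c1 b_def sum.distrib[symmetric] by (simp add: of_bool_def if_distrib cong: if_cong)
  have prod: "?c0 x * ?c1 x \<le> b * min (?c0 x) (?c1 x)" for x
  proof -
    have "?c0 x * ?c1 x = max (?c0 x) (?c1 x) * min (?c0 x) (?c1 x)"
      by (simp add: max_def min_def)
    also have "\<dots> \<le> b * min (?c0 x) (?c1 x)"
      by (intro mult_right_mono) (simp_all flip: add[of x])
    finally show ?thesis .
  qed
  have pairs: "2 * (?c0 x * ?c1 x) = (\<Sum>y\<in>C. \<Sum>z\<in>C. of_bool ((x \<in> N y) \<noteq> (x \<in> N z)))" for x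
  proof -
    have "(\<Sum>y\<in>C. \<Sum>z\<in>C. of_bool ((x \<in> N y) \<noteq> (x \<in> N z)) :: real) =
      (\<Sum>y\<in>C. \<Sum>z\<in>C. of_bool (x \<notin> N y) * of_bool (x \<in> N z) + of_bool (x \<in> N y) * of_bool (x \<notin> N z))"
      by (intro sum.cong refl) auto
    also have "\<dots> = ?c0 x * ?c1 x + ?c1 x * ?c0 x"
      unfolding c0 c1 sum.distrib sum_product ..
    finally show ?thesis by simp
  qed
  have "(\<Sum>y\<in>C. \<Sum>z\<in>C. \<delta> * of_bool (y \<noteq> z))
     \<le> (\<Sum>y\<in>C. \<Sum>z\<in>C. \<Sum>x\<in>X. p x * of_bool ((x \<in> N y) \<noteq> (x \<in> N z)))"
  proof (intro sum_mono)
    fix y z assume "y \<in> C" "z \<in> C"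
    then show "\<delta> * of_bool (y \<noteq> z) \<le> (\<Sum>x\<in>X. p x * of_bool ((x \<in> N y) \<noteq> (x \<in> N z)))"
      using sep[of y z] by (cases "y = z") auto
  qed
  also have "\<dots> = (\<Sum>x\<in>X. p x * (\<Sum>y\<in>C. \<Sum>z\<in>C. of_bool ((x \<in> N y) \<noteq> (x \<in> N z))))"
    unfolding sum_distrib_left
    by (subst sum.swap[where A = X and B = C], intro sum.cong refl, rule sum.swap)
  also have "\<dots> \<le> (\<Sum>x\<in>X. p x * (2 * (b * min (?c0 x) (?c1 x))))"
    unfolding pairs[symmetric] by (intro sum_mono mult_left_mono prod p) auto
  also have "\<dots> = b * (2 * (\<Sum>x\<in>X. p x * min (?c0 x) (?c1 x)))"
    unfolding sum_distrib_left by (intro sum.cong) auto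
  also have "(\<Sum>y\<in>C. \<Sum>z\<in>C. \<delta> * of_bool (y \<noteq> z)) = b * (\<delta> * (b - 1))"
  proof -
    have "(\<Sum>z\<in>C. \<delta> * of_bool (y \<noteq> z)) = \<delta> * (b - 1)" if "y \<in> C" for y
    proof -
      have "(\<Sum>z\<in>C. \<delta> * of_bool (y \<noteq> z)) = (\<Sum>z\<in>C. \<delta> - (if y = z then \<delta> else 0))"
        by (intro sum.cong) auto
      also have "\<dots> = \<delta> * (b - 1)"
        using assms(1) that by (simp add: sum_subtractf b_def algebra_simps)
      finally show ?thesis .
    qed
    then show ?thesis by (simp add: b_def)
  qed
  finally have "\<delta> * (b - 1) \<le> 2 * (\<Sum>x\<in>X. p x * min (?c0 x) (?c1 x))"
    using b by (simp only: mult_le_cancel_left_pos)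
  then show ?thesis using False by (simp add: b_def)
qed simp

text \<open>Sum the bound for one class over all traces on \<open>B\<close>: the classes have total
  size \<open>card Y\<close>, and the nonempty ones correspond to the traces.\<close>

lemma expected_split_weight:
  fixes p :: "'a \<Rightarrow> real"
  assumes "finite Y" "finite B" and p: "\<And>x. x \<in> X \<Longrightarrow> p x \<ge> 0"
    and sep: "\<And>y z. y \<in> Y \<Longrightarrow> z \<in> Y \<Longrightarrow> y \<noteq> z \<Longrightarrow>
      \<delta> \<le> (\<Sum>x\<in>X. p x * of_bool ((x \<in> N y) \<noteq> (x \<in> N z)))"
  shows "\<delta> / 2 * (real (card Y) - real (card ((\<lambda>y. N y \<inter> B) ` Y)))
    \<le> (\<Sum>x\<in>X. p x * split_weight N Y B x)"
proof -
  define C where "C T = {y \<in> Y. N y \<inter> B = T}" for T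
  have "(\<lambda>y. N y \<inter> B) ` Y = {T \<in> Pow B. C T \<noteq> {}}" by (auto simp: C_def)
  then have "real (card ((\<lambda>y. N y \<inter> B) ` Y)) = (\<Sum>T\<in>Pow B. of_bool (C T \<noteq> {}))"
    using assms(2) by (simp add: sum_of_bool_eq Int_def)
  moreover have "real (card Y) = (\<Sum>T\<in>Pow B. real (card (C T)))"
    unfolding C_def using sum_card_fibres[OF assms(1,2)] by simp
  ultimately have "\<delta> / 2 * (real (card Y) - real (card ((\<lambda>y. N y \<inter> B) ` Y)))
     = (\<Sum>T\<in>Pow B. \<delta> / 2 * (real (card (C T)) - of_bool (C T \<noteq> {})))"
    by (simp only: sum_subtractf sum_distrib_left[symmetric])
  also have "\<dots> \<le> (\<Sum>T\<in>Pow B. \<Sum>x\<in>X. p x *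
      min (real (card {y \<in> C T. x \<notin> N y})) (real (card {y \<in> C T. x \<in> N y})))"
    by (intro sum_mono expected_split_class p sep) (use assms(1) in \<open>auto simp: C_def\<close>)
  also have "\<dots> = (\<Sum>x\<in>X. p x * split_weight N Y B x)"
    unfolding split_weight_def sum_distrib_left C_def by (subst sum.swap) simp
  finally show ?thesis .
qed

text \<open>Double counting over \<open>m + 1\<close> samples. The split made by one sample against
  the other \<open>m\<close> has expectation at least \<open>\<delta> / 2 * (card Y - K)\<close>,
  and by exchangeability this holds at every position. Yet for any fixed outcome the splits add up
  to at most \<open>d * card Y\<close>.\<close>

lemma separated_family_bound:
  fixes p :: "'a \<Rightarrow> real"
  assumes "finite Y" and p: "\<And>x. x \<in> X \<Longrightarrow> p x \<ge> 0" "(\<Sum>x\<in>X. p x) = 1" and "\<delta> \<ge> 0"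
    and vc: "\<And>B. B \<subseteq> X \<Longrightarrow> shattered (N ` Y) B \<Longrightarrow> card B \<le> d"
    and sep: "\<And>y z. y \<in> Y \<Longrightarrow> z \<in> Y \<Longrightarrow> y \<noteq> z \<Longrightarrow>
      \<delta> \<le> (\<Sum>x\<in>X. p x * of_bool ((x \<in> N y) \<noteq> (x \<in> N z)))"
    and traces: "\<And>xs. set xs \<subseteq> X \<Longrightarrow> length xs = m \<Longrightarrow>
      real (card ((\<lambda>y. N y \<inter> set xs) ` Y)) \<le> K"
  shows "real (Suc m) * (\<delta> / 2 * (real (card Y) - K)) \<le> real d * real (card Y)"
proof -
  have "\<delta> / 2 * (real (card Y) - K) = expect X p m (\<lambda>_. \<delta> / 2 * (real (card Y) - K))"
    using p(2) by (simp add: expect_const)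
  also have "\<dots> \<le> expect X p m (\<lambda>xs. \<Sum>x\<in>X. p x * split_weight N Y (set xs) x)"
  proof (rule expect_mono[OF p(1)])
    fix xs assume xs: "set xs \<subseteq> X" "length xs = m"
    have "\<delta> / 2 * (real (card Y) - K) \<le> \<delta> / 2 * (real (card Y) - real (card ((\<lambda>y. N y \<inter> set xs) ` Y)))"
      using traces[OF xs] \<open>\<delta> \<ge> 0\<close> by (intro mult_left_mono) auto
    also have "\<dots> \<le> (\<Sum>x\<in>X. p x * split_weight N Y (set xs) x)"
      by (intro expected_split_weight assms(1) p(1) sep) auto
    finally show "\<delta> / 2 * (real (card Y) - K) \<le> (\<Sum>x\<in>X. p x * split_weight N Y (set xs) x)" .
  qed
  also have "\<dots> = (\<Sum>x\<in>X. p x * expect X p m (\<lambda>xs. split_weight N Y (set xs) x))"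
    by (simp add: expect_sum expect_cmult)
  finally have "real (Suc m) * (\<delta> / 2 * (real (card Y) - K))
      \<le> (\<Sum>i<Suc m. \<Sum>x\<in>X. p x * expect X p m (\<lambda>xs. split_weight N Y (set xs) x))"
    by (simp only: sum_constant card_lessThan) (rule mult_left_mono; simp)
  also have "\<dots> = (\<Sum>i<Suc m. expect X p (Suc m)
      (\<lambda>xs. split_weight N Y (set (take i xs @ drop (Suc i) xs)) (xs ! i)))"
    using expect_exchange[of _ m X p "\<lambda>x xs. split_weight N Y (set xs) x"]
    by (intro sum.cong refl) (simp only: lessThan_iff less_Suc_eq_le)
  also have "\<dots> = expect X p (Suc m)
      (\<lambda>xs. \<Sum>i<Suc m. split_weight N Y (set (take i xs @ drop (Suc i) xs)) (xs ! i))"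
    by (simp only: expect_sum)
  also have "\<dots> \<le> expect X p (Suc m) (\<lambda>_. real d * real (card Y))"
  proof (rule expect_mono[OF p(1)])
    fix xs assume xs: "set xs \<subseteq> X" "length xs = Suc m"
    show "(\<Sum>i<Suc m. split_weight N Y (set (take i xs @ drop (Suc i) xs)) (xs ! i))
       \<le> real d * real (card Y)"
      using sum_split_weight_le[OF assms(1) xs(1) vc] unfolding xs(2) .
  qed
  also have "\<dots> = real d * real (card Y)" by (rule expect_const[OF p(2)])
  finally show ?thesis .
qed


section \<open>Close pairs in a weighted family\<close>

text \<open>If all pairs were farther apart, \<open>separated_family_bound\<close> for the
  normalised weights would be violated with about \<open>t\<close> samples. The 4 makes up for the
  factor 1/2 there and for the half of \<open>card Y\<close> lost to the traces.\<close>

lemma exists_close_pair: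
  fixes w :: "'a \<Rightarrow> real"
  assumes "finite X" "finite Y" and "card Y \<ge> 2" and w: "\<And>x. x \<in> X \<Longrightarrow> w x \<ge> 0" and "t > 0"
    and vc: "\<And>B. B \<subseteq> X \<Longrightarrow> shattered (N ` Y) B \<Longrightarrow> card B \<le> d"
    and traces: "\<And>B. B \<subseteq> X \<Longrightarrow> B \<noteq> {} \<Longrightarrow> real (card B) < t \<Longrightarrow>
      2 * card ((\<lambda>y. N y \<inter> B) ` Y) < card Y"
  shows "\<exists>y\<in>Y. \<exists>z\<in>Y. y \<noteq> z \<and>
    (\<Sum>x\<in>X. w x * of_bool ((x \<in> N y) \<noteq> (x \<in> N z))) \<le> 4 * real d / t * (\<Sum>x\<in>X. w x)"
proof (rule ccontr)
  assume contra: "\<not> ?thesis"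
  let ?D = "\<lambda>y z. \<Sum>x\<in>X. w x * of_bool ((x \<in> N y) \<noteq> (x \<in> N z))"
  define W where "W = (\<Sum>x\<in>X. w x)"
  have far: "4 * real d / t * W < ?D y z" if "y \<in> Y" "z \<in> Y" "y \<noteq> z" for y z
    using contra that unfolding W_def by (meson not_le)
  obtain y0 z0 where yz: "y0 \<in> Y" "z0 \<in> Y" "y0 \<noteq> z0"
  proof -
    have "\<not> card Y \<le> Suc 0" using \<open>card Y \<ge> 2\<close> by simp
    then show ?thesis using that unfolding card_le_Suc0_iff_eq[OF \<open>finite Y\<close>] by blast
  qed
  have D_le: "?D y0 z0 \<le> W" unfolding W_def by (intro sum_mono) (use w in auto)
  have "W \<ge> 0" unfolding W_def by (intro sum_nonneg w)
  have "W \<noteq> 0"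
  proof
    assume "W = 0"
    with far[OF yz] D_le show False by simp
  qed
  with \<open>W \<ge> 0\<close> have "W > 0" by simp
  \<comment> \<open>In dimension 0 no single point is shattered, so all members of the family
    contain the same points of \<open>X\<close>.\<close>
  have "d \<noteq> 0"
  proof
    assume "d = 0"
    have "(x \<in> N y0) = (x \<in> N z0)" if x: "x \<in> X" for x
    proof (rule ccontr)
      assume "(x \<in> N y0) \<noteq> (x \<in> N z0)"
      then obtain u v where uv: "u \<in> Y" "v \<in> Y" "x \<in> N u" "x \<notin> N v" using yz(1,2) by metis
      have "shattered (N ` Y) {x}"
        unfolding shattered_iff
      proof (intro allI impI)
        fix C assume "C \<subseteq> {x}"
        then consider "C = {}" | "C = {x}" by (metis subset_singletonD)
        then show "\<exists>Z\<in>N ` Y. Z \<inter> {x} = C" using uv by cases auto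
      qed
      with vc[of "{x}"] x \<open>d = 0\<close> show False by simp
    qed
    then have "?D y0 z0 = 0" by (intro sum.neutral) auto
    with far[OF yz] \<open>d = 0\<close> show False by simp
  qed
  \<comment> \<open>For \<open>t \<le> 1\<close> the factor \<open>4 * real d / t\<close> is at
    least 1 and the claim is trivial. With \<open>t > 1\<close> the sample size \<open>m\<close> is
    positive, as \<open>traces\<close> speaks of nonempty sets only.\<close>
  have "t > 1"
  proof (rule ccontr)
    assume "\<not> t > 1"
    then have "1 \<le> 4 * real d / t" using \<open>d \<noteq> 0\<close> \<open>t > 0\<close> by (simp add: field_simps)
    then have "W \<le> 4 * real d / t * W" using mult_right_mono[OF _ \<open>W \<ge> 0\<close>] by fastforce
    with far[OF yz] D_le show False by simp
  qed
  \<comment> \<open>The largest integer below \<open>t\<close>: \<open>m\<close> samples obey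
    \<open>traces\<close>, while \<open>m + 1\<close> reaches \<open>t\<close>.\<close>
  define m where "m = nat \<lceil>t\<rceil> - 1"
  have m: "real m < t" "t \<le> real (Suc m)" "m > 0"
    using \<open>t > 1\<close> unfolding m_def by linarith+
  \<comment> \<open>As \<open>traces\<close> is a strict inequality of integers, \<open>K\<close>
    can be \<open>(card Y - 1) / 2\<close>; the gain over \<open>card Y / 2\<close> makes the final
    comparison strict.\<close>
  have "real (Suc m) * (4 * real d / t / 2 * (real (card Y) - (real (card Y) - 1) / 2)) \<le> real d * real (card Y)"
  proof (rule separated_family_bound[where p = "\<lambda>x. w x / W" and X = X and N = N])
    fix y z assume "y \<in> Y" "z \<in> Y" "y \<noteq> z"
    from far[OF this] have "4 * real d / t \<le> ?D y z / W" using \<open>W > 0\<close> by (simp add: pos_le_divide_eq)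
    then show "4 * real d / t \<le> (\<Sum>x\<in>X. w x / W * of_bool ((x \<in> N y) \<noteq> (x \<in> N z)))"
      by (simp add: sum_divide_distrib)
  next
    fix xs assume xs: "set xs \<subseteq> X" "length xs = m"
    have "card (set xs) \<le> m" using card_length[of xs] xs(2) by simp
    then have "2 * card ((\<lambda>y. N y \<inter> set xs) ` Y) + 1 \<le> card Y"
      using xs m(1,3) traces[of "set xs"] by fastforce
    then have "real (2 * card ((\<lambda>y. N y \<inter> set xs) ` Y) + 1) \<le> real (card Y)"
      by (simp only: of_nat_le_iff)
    then show "real (card ((\<lambda>y. N y \<inter> set xs) ` Y)) \<le> (real (card Y) - 1) / 2" by simp
  next
    show "(\<Sum>x\<in>X. w x / W) = 1"
      using \<open>W > 0\<close> unfolding sum_divide_distrib[symmetric] W_def by simp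
    show "0 \<le> w x / W" if "x \<in> X" for x using w[OF that] \<open>W > 0\<close> by simp
    show "0 \<le> 4 * real d / t" using \<open>t > 0\<close> by simp
    show "card B \<le> d" if "B \<subseteq> X" "shattered (N ` Y) B" for B by (rule vc[OF that])
  qed fact
  moreover have "real (Suc m) * (4 * real d / t / 2 * (real (card Y) - (real (card Y) - 1) / 2))
      = real (Suc m) * real d * (real (card Y) + 1) / t"
    by (simp add: divide_simps)
  ultimately have "real (Suc m) * real d * (real (card Y) + 1) \<le> t * (real d * real (card Y))"
    using \<open>t > 0\<close> by (simp only: pos_divide_le_eq mult.commute)
  moreover have "t * (real d * real (card Y)) < real (Suc m) * real d * (real (card Y) + 1)"
  proof -
    have "t * (real d * real (card Y)) < t * (real d * (real (card Y) + 1))"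
      using \<open>t > 0\<close> \<open>d \<noteq> 0\<close> by simp
    also have "\<dots> \<le> real (Suc m) * (real d * (real (card Y) + 1))"
      by (intro mult_right_mono m) simp
    finally show ?thesis by (simp only: mult.assoc)
  qed
  ultimately show False by linarith
qed

section \<open>Alternations along paths and greedy joining\<close>

fun alternations :: "('a \<Rightarrow> bool) \<Rightarrow> 'a list \<Rightarrow> nat" where
  "alternations Q (x # y # zs) = of_bool (Q x \<noteq> Q y) + alternations Q (y # zs)"
| "alternations Q _ = 0"

lemma alternations_append:
  assumes "xs \<noteq> []" "ys \<noteq> []"
  shows "alternations Q (xs @ ys) =
    alternations Q xs + of_bool (Q (last xs) \<noteq> Q (hd ys)) + alternations Q ys"
  using assms
proof (induction Q xs rule: alternations.induct)
  case ("2_2" Q x)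
  then show ?case by (cases ys) auto
qed auto

lemma alternations_rev: "alternations Q (rev xs) = alternations Q xs"
proof (induction xs)
  case (Cons x xs)
  note IH = Cons.IH
  show ?case
  proof (cases xs)
    case (Cons y ys)
    have "alternations Q (rev xs @ [x]) = alternations Q xs + of_bool (Q y \<noteq> Q x)"
      using IH Cons by (subst alternations_append) (simp_all add: last_rev del: rev.simps)
    then show ?thesis using Cons by auto
  qed simp
qed simp

text \<open>The potential is the sum over \<open>v\<close> of 2 to the number of alternations of
  \<open>v\<close> in all paths. Joining two paths at their heads doubles the terms of exactly those
  \<open>v\<close> that distinguish the heads. By \<open>close\<close>, some two heads raise the
  potential by at most the factor \<open>1 + \<epsilon> (card P)\<close>, and one path fewer
  remains.\<close>

lemma merge_paths:
  fixes Q :: "'v \<Rightarrow> 'a \<Rightarrow> bool" and \<epsilon> :: "nat \<Rightarrow> real"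
  assumes close: "\<And>Y w. Y \<subseteq> V \<Longrightarrow> card Y \<ge> 2 \<Longrightarrow> (\<And>v. w v \<ge> 0) \<Longrightarrow>
      \<exists>y\<in>Y. \<exists>z\<in>Y. y \<noteq> z \<and>
        (\<Sum>v\<in>X. w v * of_bool (Q v y \<noteq> Q v z)) \<le> \<epsilon> (card Y) * (\<Sum>v\<in>X. w v)"
    and \<epsilon>: "\<And>j. j \<le> card P \<Longrightarrow> 2 \<le> j \<Longrightarrow> \<epsilon> j \<ge> 0"
    and "finite P" "P \<noteq> {}" "[] \<notin> P" "\<And>xs. xs \<in> P \<Longrightarrow> distinct xs"
    and "disjoint_family_on set P" "(\<Union>xs\<in>P. set xs) = V"
  shows "\<exists>zs. distinct zs \<and> set zs = V \<and>
    (\<Sum>v\<in>X. 2 ^ alternations (Q v) zs)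
      \<le> (\<Sum>v\<in>X. 2 ^ (\<Sum>xs\<in>P. alternations (Q v) xs)) * (\<Prod>j=2..card P. 1 + \<epsilon> j)"
  using assms(2-)
proof (induction "card P" arbitrary: P rule: less_induct)
  case less
  note fin = less.prems(2) and ne = less.prems(4) and dist = less.prems(5) and disj = less.prems(6)
  show ?case
  proof (cases "card P \<ge> 2")
    case False
    with less.prems(2,3) have "card P = 1"
      by (metis One_nat_def card_0_eq le_less_Suc_eq less_2_cases not_less numeral_2_eq_2 zero_less_iff_neq_zero)
    then obtain xs where "P = {xs}" by (auto simp: card_1_singleton_iff)
    with less.prems show ?thesis by (intro exI[of _ xs]) auto
  next
    case True
    have hd_in: "hd xs \<in> set xs" if "xs \<in> P" for xs using that ne by (metis hd_in_set)
    have inj: "inj_on hd P"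
      using hd_in disj by (intro inj_onI) (metis disjoint_family_on_def disjoint_iff)
    define w :: "'v \<Rightarrow> real" where "w v = 2 ^ (\<Sum>xs\<in>P. alternations (Q v) xs)" for v
    have "hd ` P \<subseteq> V" "card (hd ` P) = card P"
      using hd_in less.prems(7) card_image[OF inj] by auto
    with close[of "hd ` P" w] True obtain xs ys where xy: "xs \<in> P" "ys \<in> P" "hd xs \<noteq> hd ys"
      and cl: "(\<Sum>v\<in>X. w v * of_bool (Q v (hd xs) \<noteq> Q v (hd ys))) \<le> \<epsilon> (card P) * (\<Sum>v\<in>X. w v)"
      by (auto simp: w_def)
    have neq: "xs \<noteq> ys" "xs \<noteq> []" "ys \<noteq> []" using xy ne by auto
    define R where "R = P - {xs, ys}"
    \<comment> \<open>Reversing \<open>xs\<close> makes the two heads adjacent; the last element of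
      \<open>xs\<close> becomes the head of the new path.\<close>
    define us where "us = rev xs @ ys"
    have P: "P = insert xs (insert ys R)" "xs \<notin> insert ys R" "ys \<notin> R" "finite R"
      using xy neq fin by (auto simp: R_def)
    have cardP: "card P = Suc (Suc (card R))" using P by simp
    have us: "set us = set xs \<union> set ys" "us \<noteq> []" using neq by (auto simp: us_def)
    have disjR: "set xs \<inter> set ys = {}" "\<And>zs. zs \<in> R \<Longrightarrow> set us \<inter> set zs = {}"
      using disj xy neq(1) us(1) unfolding disjoint_family_on_def R_def by blast+
    have usR: "us \<notin> R" using disjR(2)[of us] us(2) by auto
    have *: "\<exists>zs. distinct zs \<and> set zs = V \<and>
      (\<Sum>v\<in>X. 2 ^ alternations (Q v) zs)
        \<le> (\<Sum>v\<in>X. 2 ^ (\<Sum>xs\<in>insert us R. alternations (Q v) xs)) * (\<Prod>j=2..card (insert us R). 1 + \<epsilon> j)"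
    proof (rule less.hyps)
      show "card (insert us R) < card P" using usR P(4) cardP by simp
      show "\<And>j. j \<le> card (insert us R) \<Longrightarrow> 2 \<le> j \<Longrightarrow> \<epsilon> j \<ge> 0"
        using less.prems(1) usR P(4) cardP by simp
      show "[] \<notin> insert us R" using us(2) ne by (auto simp: R_def)
      show "distinct zs" if "zs \<in> insert us R" for zs
        using that dist xy disjR(1) by (auto simp: us_def R_def)
      have "disjoint_family_on set R"
        using disj by (rule disjoint_family_on_mono[rotated]) (auto simp: R_def)
      then show "disjoint_family_on set (insert us R)"
        using disjR(2) usR by (auto simp: disjoint_family_on_insert)
      show "(\<Union>xs\<in>insert us R. set xs) = V"
        using less.prems(7) us(1) unfolding P(1) by auto
    qed (use P(4) in auto)
    have step: "(\<Sum>v\<in>X. 2 ^ (\<Sum>xs\<in>insert us R. alternations (Q v) xs)) \<le> (1 + \<epsilon> (card P)) * (\<Sum>v\<in>X. w v)"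
    proof -
      have "(2::real) ^ (\<Sum>xs\<in>insert us R. alternations (Q v) xs) = w v + w v * of_bool (Q v (hd xs) \<noteq> Q v (hd ys))" for v
      proof -
        have "alternations (Q v) us = alternations (Q v) xs + alternations (Q v) ys + of_bool (Q v (hd xs) \<noteq> Q v (hd ys))"
          using neq by (simp add: us_def alternations_append alternations_rev last_rev)
        then have "(\<Sum>xs\<in>insert us R. alternations (Q v) xs) =
            (\<Sum>xs\<in>P. alternations (Q v) xs) + of_bool (Q v (hd xs) \<noteq> Q v (hd ys))"
          using P usR by simp
        then show ?thesis by (simp add: w_def power_add)
      qed
      with cl show ?thesis by (simp add: sum.distrib algebra_simps)
    qed
    have pos: "(\<Prod>j=2..card (insert us R). 1 + \<epsilon> j) \<ge> 0"
    proof (rule prod_nonneg)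
      fix j assume "j \<in> {2..card (insert us R)}"
      then show "0 \<le> 1 + \<epsilon> j" using less.prems(1)[of j] usR P(4) cardP by auto
    qed
    have "(1 + \<epsilon> (card P)) * (\<Sum>v\<in>X. w v) * (\<Prod>j=2..card (insert us R). 1 + \<epsilon> j)
      = (\<Sum>v\<in>X. w v) * (\<Prod>j=2..card P. 1 + \<epsilon> j)"
      using usR P(4) cardP by (simp add: prod.nat_ivl_Suc')
    with * mult_right_mono[OF step pos] show ?thesis unfolding w_def by force
  qed
qed

section \<open>From lists to intervals of a linear order\<close>

definition list_order :: "'a list \<Rightarrow> 'a rel" where
  "list_order zs = {(zs ! i, zs ! k) | i k. i \<le> k \<and> k < length zs}"

lemma list_order_nth_iff:
  assumes "distinct zs" "i < length zs" "k < length zs"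
  shows "(zs ! i, zs ! k) \<in> list_order zs \<longleftrightarrow> i \<le> k"
proof
  assume "(zs ! i, zs ! k) \<in> list_order zs"
  then obtain i' k' where *: "zs ! i = zs ! i'" "zs ! k = zs ! k'" "i' \<le> k'" "k' < length zs"
    unfolding list_order_def by blast
  then show "i \<le> k" using assms nth_eq_iff_index_eq[OF assms(1)] by simp
qed (use assms in \<open>auto simp: list_order_def\<close>)

lemma linear_order_list_order:
  assumes "distinct zs"
  shows "linear_order_on (set zs) (list_order zs)"
proof -
  note iff = list_order_nth_iff[OF assms]
  have sub: "list_order zs \<subseteq> set zs \<times> set zs" by (auto simp: list_order_def)
  have "refl_on (set zs) (list_order zs)"
    by (auto intro!: refl_onI simp: in_set_conv_nth iff)
  moreover have "trans (list_order zs)"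
  proof (rule transI)
    fix x y z assume xyz: "(x, y) \<in> list_order zs" "(y, z) \<in> list_order zs"
    with sub have "x \<in> set zs" "y \<in> set zs" "z \<in> set zs" by blast+
    with xyz show "(x, z) \<in> list_order zs" by (auto simp: in_set_conv_nth iff)
  qed
  moreover have "antisym (list_order zs)"
  proof (rule antisymI)
    fix x y assume xy: "(x, y) \<in> list_order zs" "(y, x) \<in> list_order zs"
    with sub have "x \<in> set zs" "y \<in> set zs" by blast+
    with xy show "x = y" by (auto simp: in_set_conv_nth iff)
  qed
  moreover have "total_on (set zs) (list_order zs)"
    by (auto simp: total_on_def in_set_conv_nth iff)
  ultimately show ?thesis
    using sub by (simp add: linear_order_on_def partial_order_on_def preorder_on_def)
qed

text \<open>Members of \<open>S\<close> are preceded by an even number of alternations, or all by an odd number,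
  so grouping them by half that number separates maximal runs.\<close>
lemma alternations_partition:
  assumes "distinct zs" "S \<subseteq> set zs"
  shows "\<exists>P. partition_on S P \<and> card P \<le> alternations (\<lambda>x. x \<in> S) zs div 2 + 1 \<and>
    (\<forall>I\<in>P. interval_in (set zs) (list_order zs) I)"
proof (cases "zs = []")
  case True
  with assms(2) show ?thesis by (intro exI[of _ "{}"]) (auto simp: partition_on_def)
next
  case False
  define c where "c i = alternations (\<lambda>x. x \<in> S) (take (Suc i) zs)" for i
  let ?k = "alternations (\<lambda>x. x \<in> S) zs"
  define I where "I q = {zs ! i | i. i < length zs \<and> zs ! i \<in> S \<and> c i div 2 = q}" for q
  have step: "c (Suc i) = c i + of_bool ((zs ! i \<in> S) \<noteq> (zs ! Suc i \<in> S))" if "Suc i < length zs" for i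
  proof -
    have "take (Suc (Suc i)) zs = take (Suc i) zs @ [zs ! Suc i]"
      using that by (rule take_Suc_conv_app_nth)
    moreover have "last (take (Suc i) zs) = zs ! i"
      using that by (simp add: take_Suc_conv_app_nth)
    ultimately show ?thesis using that False
      unfolding c_def by (simp add: alternations_append)
  qed
  have mono: "c i \<le> c k" if "i \<le> k" "k < length zs" for i k
    using that by (induction k rule: dec_induct) (use step in fastforce)+
  \<comment> \<open>Each alternation switches membership in \<open>S\<close>, so parity compares
    position \<open>i\<close> with the first position.\<close>
  have par: "even (c i) = ((zs ! i \<in> S) = (zs ! 0 \<in> S))" if "i < length zs" for i
    using that
  proof (induction i)
    case 0
    then show ?case using False by (cases zs) (auto simp: c_def)
  next
    case (Suc i)
    then show ?case using step[of i] by auto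
  qed
  have last: "c i \<le> ?k" if "i < length zs" for i
    using mono[of i "length zs - 1"] that False by (simp add: c_def)
  have between: "interval_in (set zs) (list_order zs) (I q)" for q
    unfolding interval_in_def
  proof (intro conjI ballI impI)
    show "I q \<subseteq> set zs" by (auto simp: I_def)
    fix x z y assume xz: "x \<in> I q" "z \<in> I q" and "y \<in> set zs"
      and xyz: "(x, y) \<in> list_order zs \<and> (y, z) \<in> list_order zs"
    then obtain i j k where ijk: "x = zs ! i" "y = zs ! j" "z = zs ! k"
      "i < length zs" "j < length zs" "k < length zs"
      by (auto simp: I_def in_set_conv_nth)
    with xyz have ord: "i \<le> j" "j \<le> k" by (auto simp: list_order_nth_iff[OF assms(1)])
    have xz: "zs ! i \<in> S" "c i div 2 = q" "zs ! k \<in> S" "c k div 2 = q"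
      using xz ijk assms(1) by (auto simp: I_def nth_eq_iff_index_eq)
    have le: "c i \<le> c j" "c j \<le> c k" using ord ijk mono by auto
    \<comment> \<open>Equal parity and equal halves force equal counts; by monotonicity the count,
      hence membership, is the same in between.\<close>
    have "even (c i) = even (c k)" using par xz ijk by simp
    then have "c i = c k" using xz(2,4) by (metis even_two_times_div_two odd_two_times_div_two_succ)
    then have "c j = c i" using le by simp
    then have "zs ! j \<in> S" using par[of i] par[of j] xz ijk by auto
    then show "y \<in> I q" unfolding I_def using \<open>c j = c i\<close> xz(2) ijk by auto
  qed
  \<comment> \<open>The halves range from 0 to \<open>?k div 2\<close>, whence the summand 1. Empty
    groups are dropped, as parts of a partition are nonempty.\<close>
  let ?P = "I ` {..?k div 2} - {{}}"
  have "partition_on S ?P"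
    unfolding partition_on_def
  proof (intro conjI)
    have "x \<in> \<Union> ?P" if x: "x \<in> S" for x
    proof -
      obtain i where i: "i < length zs" "x = zs ! i" using x assms(2) by (metis in_set_conv_nth subsetD)
      then have "x \<in> I (c i div 2)" using x by (auto simp: I_def)
      moreover have "c i div 2 \<le> ?k div 2" by (intro div_le_mono last i)
      ultimately show ?thesis by blast
    qed
    then show "\<Union> ?P = S" by (auto simp: I_def)
    have "q = q'" if "x \<in> I q" "x \<in> I q'" for x q q'
      using that assms(1) by (auto simp: I_def nth_eq_iff_index_eq)
    then show "disjoint ?P" unfolding disjoint_def by blast
  qed auto
  moreover have "card ?P \<le> card (I ` {..?k div 2})" by (intro card_mono) auto
  moreover have "card (I ` {..?k div 2}) \<le> ?k div 2 + 1"
    using card_image_le[of "{..?k div 2}" I] by simp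
  ultimately show ?thesis using between by (intro exI[of _ ?P]) auto
qed


lemma contiguity_le:
  assumes "distinct zs" "set zs = verts G"
    and "\<And>v. v \<in> verts G \<Longrightarrow> alternations (\<lambda>u. u \<in> nbhd G v) zs \<le> k"
  shows "contiguity G \<le> k div 2 + 1"
  unfolding contiguity_def
proof (rule Least_le, intro exI[of _ "list_order zs"] conjI ballI)
  show "linear_order_on (verts G) (list_order zs)"
    using linear_order_list_order[OF assms(1)] assms(2) by simp
  fix v assume v: "v \<in> verts G"
  have "nbhd G v \<subseteq> set zs" using assms(2) by (auto simp: nbhd_def)
  from alternations_partition[OF assms(1) this] obtain P where
    P: "partition_on (nbhd G v) P" "card P \<le> alternations (\<lambda>u. u \<in> nbhd G v) zs div 2 + 1"
      "\<forall>I\<in>P. interval_in (verts G) (list_order zs) I"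
    unfolding assms(2) by blast
  moreover have "card P \<le> k div 2 + 1"
    using P(2) div_le_mono[OF assms(3)[OF v], of 2] by linarith
  ultimately show "\<exists>P. partition_on (nbhd G v) P \<and> card P \<le> k div 2 + 1 \<and>
      (\<forall>I\<in>P. interval_in (verts G) (list_order zs) I)" by blast
qed

section \<open>Assembling the bound for graphs\<close>

lemma card_le_vc_dim:
  assumes "finite X" "B \<subseteq> X" "shattered S B"
  shows "card B \<le> vc_dim X S"
  unfolding vc_dim_def using assms by (intro Max_ge) auto

lemma traces_le_nbhd_complexity:
  assumes "finite (verts G)" "B \<subseteq> verts G" "Y \<subseteq> verts G"
  shows "card ((\<lambda>y. nbhd G y \<inter> B) ` Y) \<le> nbhd_complexity G (card B)"
proof -
  have "card ((\<lambda>y. nbhd G y \<inter> B) ` Y) \<le> card {nbhd G v \<inter> B | v. v \<in> verts G}"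
    using assms by (intro card_mono) auto
  also have "\<dots> \<le> nbhd_complexity G (card B)"
    unfolding nbhd_complexity_def using assms(1,2) by (intro Max_ge) auto
  finally show ?thesis .
qed

text \<open>By \<open>exp 1 \<le> 3 \<le> 4\<close>. Passing from \<open>ln\<close> to
  \<open>log 2\<close> thus costs a factor of at most 2, turning 4 into 8, which is below twice the
  constant 5 of the theorem.\<close>

lemma half_le_ln_2: "1 / 2 \<le> ln (2::real)"
proof -
  have "exp 1 \<le> (2::real) ^ 2" using exp_le by simp
  then have "1 \<le> ln ((2::real) ^ 2)" by (subst ln_ge_iff) auto
  then have "1 \<le> 2 * ln (2::real)" by (subst (asm) ln_realpow) auto
  then show ?thesis by simp
qed

theorem theorem4p3:
  fixes G :: "('a, 'b) pre_digraph" and f :: "real \<Rightarrow> real" and n d :: nat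
  assumes "graph G"
    and "card (verts G) = n"
    and "f ` {0..} \<subseteq> {0..}"
    and "strict_mono_on {0..} f"
    \<comment> \<open>each \<open>1 / f\<^sup>-\<^sup>1(j/2)\<close> below is defined; automatic if \<open>f\<close> is a bijection of \<open>[0,\<infinity>)\<close>\<close>
    and "\<forall>j\<in>{1..n}. real j / 2 \<in> f ` {0<..}"
    and "vc_dim (verts G) (nbhd_system G) = d"
    and "\<forall>m\<in>{1..n}. real (nbhd_complexity G m) \<le> f (real m)"
  shows "real (contiguity G) \<le>
    1 + log 2 (real n) + 5 * real d * (\<Sum>j=1..n. 1 / inv_into {0..} f (real j / 2))"
proof -
  interpret graph G by fact
  define N where "N = nbhd G"
  define t where "t j = inv_into {0..} f (real j / 2)" for j :: nat
  define \<epsilon> where "\<epsilon> j = 4 * real d / t j" for j :: nat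
  have fin: "finite (verts G)" by simp
  have inj: "inj_on f {0..}" using assms(4) by (rule strict_mono_on_imp_inj_on)
  have t: "t j > 0 \<and> f (t j) = real j / 2" if "1 \<le> j" "j \<le> n" for j
  proof -
    have "j \<in> {1..n}" using that by simp
    then have "real j / 2 \<in> f ` {0<..}" by (rule bspec[OF assms(5)])
    then obtain x where "real j / 2 = f x" "x > 0" by (elim imageE) simp
    then show ?thesis unfolding t_def using inv_into_f_f[OF inj, of x] by simp
  qed
  \<comment> \<open>Symmetry turns closeness of the neighborhoods of \<open>y\<close> and
    \<open>z\<close> into a small weight of the \<open>v\<close> that separate \<open>y\<close> from
    \<open>z\<close>.\<close>
  have sym: "u \<in> N v \<longleftrightarrow> v \<in> N u" if "u \<in> verts G" "v \<in> verts G" for u v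
    using that sym_arcs unfolding N_def nbhd_def symmetric_def by (auto dest: symD)
  have close: "\<exists>y\<in>Y. \<exists>z\<in>Y. y \<noteq> z \<and>
      (\<Sum>v\<in>verts G. w v * of_bool ((y \<in> N v) \<noteq> (z \<in> N v))) \<le> \<epsilon> (card Y) * (\<Sum>v\<in>verts G. w v)"
    if Y: "Y \<subseteq> verts G" "2 \<le> card Y" and w: "\<And>v. w v \<ge> 0" for Y and w :: "'a \<Rightarrow> real"
  proof -
    have "card Y \<le> n" using card_mono[OF fin Y(1)] assms(2) by simp
    with Y(2) t have tY: "t (card Y) > 0" "f (t (card Y)) = real (card Y) / 2" by auto
    have "\<exists>y\<in>Y. \<exists>z\<in>Y. y \<noteq> z \<and>
      (\<Sum>v\<in>verts G. w v * of_bool ((v \<in> N y) \<noteq> (v \<in> N z)))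
        \<le> 4 * real d / t (card Y) * (\<Sum>v\<in>verts G. w v)"
    proof (rule exists_close_pair)
      fix B assume B: "B \<subseteq> verts G" "shattered (N ` Y) B"
      have "shattered (nbhd_system G) B"
        by (rule shattered_trans[OF B(2)]) (use Y(1) in \<open>auto simp: nbhd_system_def N_def\<close>)
      from card_le_vc_dim[OF fin B(1) this] show "card B \<le> d" unfolding assms(6) .
    next
      \<comment> \<open>At most \<open>f (card B)\<close> traces remain, and strict monotonicity
        puts this below \<open>f (t (card Y)) = card Y / 2\<close>. As \<open>B\<close> is nonempty,
        \<open>card B\<close> lies in the range of the complexity hypothesis.\<close>
      fix B assume B: "B \<subseteq> verts G" "B \<noteq> {}" "real (card B) < t (card Y)"
      have "card B \<in> {1..n}"
        using B card_mono[OF fin B(1)] finite_subset[OF B(1) fin] assms(2)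
        by (simp add: Suc_le_eq card_gt_0_iff)
      then have "real (nbhd_complexity G (card B)) \<le> f (real (card B))" using assms(7) by blast
      moreover have "card ((\<lambda>y. N y \<inter> B) ` Y) \<le> nbhd_complexity G (card B)"
        unfolding N_def by (rule traces_le_nbhd_complexity[OF fin B(1) Y(1)])
      moreover have "f (real (card B)) < f (t (card Y))"
        using B(3) tY(1) by (intro strict_mono_onD[OF assms(4)]) auto
      ultimately show "2 * card ((\<lambda>y. N y \<inter> B) ` Y) < card Y" using tY(2) by linarith
    qed (use fin finite_subset[OF Y(1)] Y(2) w tY in auto)
    then obtain y z where yz: "y \<in> Y" "z \<in> Y" "y \<noteq> z"
      "(\<Sum>v\<in>verts G. w v * of_bool ((v \<in> N y) \<noteq> (v \<in> N z))) \<le> \<epsilon> (card Y) * (\<Sum>v\<in>verts G. w v)"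
      unfolding \<epsilon>_def by blast
    have "(\<Sum>v\<in>verts G. w v * of_bool ((y \<in> N v) \<noteq> (z \<in> N v)))
       = (\<Sum>v\<in>verts G. w v * of_bool ((v \<in> N y) \<noteq> (v \<in> N z)))"
      using yz(1,2) Y(1) by (intro sum.cong refl) (use sym in auto)
    with yz(4) have "(\<Sum>v\<in>verts G. w v * of_bool ((y \<in> N v) \<noteq> (z \<in> N v)))
        \<le> \<epsilon> (card Y) * (\<Sum>v\<in>verts G. w v)"
      by (simp only:)
    with yz(1-3) show ?thesis by blast
  qed
  show ?thesis
  proof (cases "n = 0")
    \<comment> \<open>The sum is empty and \<open>log 2 0\<close> is 0 by convention, so the
      right-hand side is 1.\<close>
    case True
    then have "contiguity G \<le> 0 div 2 + 1"
      using assms(2) by (intro contiguity_le[of "[]"]) auto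
    then show ?thesis using True by (simp add: log_def)
  next
    case False
    \<comment> \<open>One-vertex paths have no alternations, so the initial potential is
      \<open>n\<close>.\<close>
    let ?P = "(\<lambda>x. [x]) ` verts G"
    have cardP: "card ?P = n" using assms(2) by (simp add: card_image inj_on_def)
    have \<epsilon>: "\<epsilon> j \<ge> 0" if "1 \<le> j" "j \<le> n" for j using t[OF that] by (simp add: \<epsilon>_def)
    have "\<exists>zs. distinct zs \<and> set zs = verts G \<and>
      (\<Sum>v\<in>verts G. 2 ^ alternations (\<lambda>u. u \<in> N v) zs)
      \<le> (\<Sum>v\<in>verts G. 2 ^ (\<Sum>xs\<in>?P. alternations (\<lambda>u. u \<in> N v) xs)) * (\<Prod>j=2..card ?P. 1 + \<epsilon> j)"
    proof (rule merge_paths[OF close])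
      show "?P \<noteq> {}" using False assms(2) by auto
      show "\<epsilon> j \<ge> 0" if "j \<le> card ?P" "2 \<le> j" for j using that \<epsilon> cardP by simp
    qed (auto simp: disjoint_family_on_def)
    moreover have "(\<Sum>v\<in>verts G. (2::real) ^ (\<Sum>xs\<in>?P. alternations (\<lambda>u. u \<in> N v) xs)) = real n"
    proof -
      have zero: "(\<Sum>xs\<in>?P. alternations (\<lambda>u. u \<in> N v) xs) = 0" for v
        by (intro sum.neutral) auto
      show ?thesis unfolding zero using assms(2) by simp
    qed
    ultimately obtain zs where zs: "distinct zs" "set zs = verts G"
      and total: "(\<Sum>v\<in>verts G. 2 ^ alternations (\<lambda>u. u \<in> N v) zs) \<le> real n * (\<Prod>j=2..n. 1 + \<epsilon> j)"
      unfolding cardP by auto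
    \<comment> \<open>The binary logarithm of the bound on the final potential. Each term of the
      potential is at most the total, so \<open>L\<close> bounds every alternation count.\<close>
    define L where "L = log 2 (real n) + (\<Sum>j=2..n. log 2 (1 + \<epsilon> j))"
    have pos: "1 + \<epsilon> j > 0" if "j \<in> {2..n}" for j using \<epsilon>[of j] that by simp
    have logn: "log 2 (real n) \<ge> 0" using False by (intro zero_le_log_cancel_iff[THEN iffD2]) auto
    have logs: "0 \<le> log 2 (1 + \<epsilon> j)" "log 2 (1 + \<epsilon> j) \<le> 8 * real d / t j" if "j \<in> {2..n}" for j
    proof -
      have e: "\<epsilon> j \<ge> 0" using \<epsilon> that by simp
      show "0 \<le> log 2 (1 + \<epsilon> j)" using e by simp
      have "log 2 (1 + \<epsilon> j) \<le> \<epsilon> j / ln 2"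
        unfolding log_def using ln_add_one_self_le_self[OF e] half_le_ln_2 by (intro divide_right_mono) auto
      also have "\<dots> \<le> \<epsilon> j / (1 / 2)" using half_le_ln_2 e by (intro divide_left_mono) auto
      finally show "log 2 (1 + \<epsilon> j) \<le> 8 * real d / t j" by (simp add: \<epsilon>_def)
    qed
    have L: "log 2 (real n * (\<Prod>j=2..n. 1 + \<epsilon> j)) = L"
    proof -
      have "ln (real n * (\<Prod>j=2..n. 1 + \<epsilon> j)) = ln (real n) + ln (\<Prod>j=2..n. 1 + \<epsilon> j)"
        using False pos by (intro ln_mult_pos prod_pos) auto
      also have "ln (\<Prod>j=2..n. 1 + \<epsilon> j) = (\<Sum>j=2..n. ln (1 + \<epsilon> j))"
        using pos by (intro ln_prod) (simp_all add: less_imp_neq[symmetric])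
      finally show ?thesis by (simp add: L_def log_def add_divide_distrib sum_divide_distrib)
    qed
    have "L \<ge> 0" unfolding L_def by (intro add_nonneg_nonneg logn sum_nonneg logs)
    have alt: "alternations (\<lambda>u. u \<in> nbhd G v) zs \<le> nat \<lfloor>L\<rfloor>" if v: "v \<in> verts G" for v
    proof -
      have "(2::real) ^ alternations (\<lambda>u. u \<in> N v) zs \<le> (\<Sum>v\<in>verts G. 2 ^ alternations (\<lambda>u. u \<in> N v) zs)"
        using v fin by (intro member_le_sum) auto
      then have "2 powr real (alternations (\<lambda>u. u \<in> N v) zs) \<le> real n * (\<Prod>j=2..n. 1 + \<epsilon> j)"
        using total by (simp add: powr_realpow)
      moreover from this have "0 < real n * (\<Prod>j=2..n. 1 + \<epsilon> j)"
        by (rule less_le_trans[rotated]) simp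
      ultimately have "real (alternations (\<lambda>u. u \<in> N v) zs) \<le> L"
        unfolding L[symmetric] by (subst le_log_iff) auto
      then show ?thesis unfolding N_def by (rule le_nat_floor)
    qed
    have "contiguity G \<le> nat \<lfloor>L\<rfloor> div 2 + 1" by (rule contiguity_le[OF zs alt])
    then have "real (contiguity G) \<le> 1 + L / 2" using \<open>L \<ge> 0\<close> by linarith
    \<comment> \<open>Half of \<open>log 2 (real n)\<close> is given away here; below, 8 is raised
      to 10 and the nonnegative term \<open>j = 1\<close> is added to reach the stated form.\<close>
    also have "L / 2 \<le> log 2 (real n) + (\<Sum>j=2..n. log 2 (1 + \<epsilon> j)) / 2"
      using logn by (simp add: L_def)
    also have "(\<Sum>j=2..n. log 2 (1 + \<epsilon> j)) \<le> (\<Sum>j=2..n. 8 * real d / t j)"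
      by (intro sum_mono logs)
    also have "\<dots> \<le> (\<Sum>j=1..n. 10 * real d / t j)"
    proof -
      have "(\<Sum>j=2..n. 8 * real d / t j) \<le> (\<Sum>j=2..n. 10 * real d / t j)"
        using t by (intro sum_mono divide_right_mono) (auto intro: less_imp_le)
      also have "\<dots> \<le> (\<Sum>j=1..n. 10 * real d / t j)"
        using t by (intro sum_mono2) (auto intro!: divide_nonneg_pos)
      finally show ?thesis .
    qed
    also have "(\<Sum>j=1..n. 10 * real d / t j) / 2 = 5 * real d * (\<Sum>j=1..n. 1 / t j)"
      by (simp add: sum_distrib_left sum_divide_distrib)
    finally show ?thesis by (simp add: t_def add.assoc)
  qed
qed

end
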